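(* Let $m\ge1$, let $I$ be a finite nonempty set, and for each $i\in I$ let $q_i>0$ and let $\mathcal{V}_i\subset\mathbb{R}^m$ be an uncertainty set. Under the multinomial logit (MNL) model, the worst-case objective function $$f^{\mathrm{WC}}(\mathbf{x})=\sum_{i\in I}q_i-\sum_{i\in I}\frac{q_i}{1+\min_{\mathbf{v}^i\in\mathcal{V}_i}\left\{\sum_{j\in[m]}e^{v_{ij}}x_j\right\}},\qquad \mathbf{x}\in[0,1]^m,$$ is concave in $\mathbf{x}$.
   Context: $[m]=\{1,\dots,m\}$; $\mathbf{v}^i=(v_{ij})_{j\in[m]}$ are the utilities of the locations for customer zone $i$, and $q_i$ is the number of customers in zone $i$. Under the MNL model the choice probability generating function is $G^i(\mathbf{Y})=\sum_{j\in[m]}Y_j$, giving the displayed expression. Uncertainty sets: each $\mathcal{V}_i\subset\mathbb{R}^m$ is nonempty, convex and bounded, of the form $\{\mathbf{v}\in\mathbb{R}^m: g^i_t(\mathbf{v})\le 0,\ t=1,\dots,T\}$ with convex functions $g^i_t:\mathbb{R}^m\to\mathbb{R}$; the sets are independent across $i\in I$. *)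

theory Defs
  imports "HOL-Analysis.Analysis"
begin

definition uncertainty_set :: "(real ^ 'n) set \<Rightarrow> bool" where
  "uncertainty_set V \<longleftrightarrow>
     V \<noteq> {} \<and> convex V \<and> bounded V \<and>
     (\<exists>(T::nat) g :: nat \<Rightarrow> real ^ 'n \<Rightarrow> real.
        (\<forall>t\<in>{1..T}. convex_on UNIV (g t)) \<and> V = {v. \<forall>t\<in>{1..T}. g t v \<le> 0})"

(* The minimum of f over S, for a possibly infinite S (the library's Min is for finite sets).
   LEAST is an unspecified value unless a least element exists, so nothing can be concluded
   about min_over f S without showing that the minimum is attained. *)
definition min_over :: "('b \<Rightarrow> real) \<Rightarrow> 'b set \<Rightarrow> real" where
  "min_over f S = (LEAST y. y \<in> f ` S)"

definition worst_case_mnl ::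
    "'i set \<Rightarrow> ('i \<Rightarrow> real) \<Rightarrow> ('i \<Rightarrow> (real ^ 'n) set) \<Rightarrow> real ^ 'n \<Rightarrow> real" where
  "worst_case_mnl I q V x =
     (\<Sum>i\<in>I. q i) -
     (\<Sum>i\<in>I. q i / (1 + min_over (\<lambda>v. \<Sum>j\<in>UNIV. exp (v $ j) * x $ j) (V i)))"

end

theory Submission
  imports Defs
begin

text \<open>
  For a fixed utility vector the sum of exponentials is linear in the location vector, so its
  minimum over the uncertainty set is a pointwise minimum of linear functions and hence concave
  (\<open>concave_on_min_over\<close>). The minimum is nonnegative on the cube because all summands are
  nonnegative there, so the denominator is a concave function that is at least 1. The
  reciprocal is convex and decreasing on the positive reals, so composing it with a positive
  concave function gives a convex function (\<open>convex_on_inverse_concave\<close>).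
  Thus each zone contributes a constant minus a convex function.

  The minimum only has this meaning when it is attained, which follows from compactness:
  a convex function that is finite on the whole space is continuous, so an uncertainty set is
  closed, and it is bounded by assumption (\<open>compact_uncertainty_set\<close>).
\<close>

text \<open>
  Closedness holds because each constraint cuts out a sublevel set of a function whose convexity
  on the whole of a finite-dimensional space forces continuity.
\<close>

lemma compact_uncertainty_set:
  fixes V :: "(real ^ 'n) set"
  assumes "uncertainty_set V"
  shows "compact V"
proof -
  obtain T :: nat and g :: "nat \<Rightarrow> real ^ 'n \<Rightarrow> real"
    where g: "\<forall>t\<in>{1..T}. convex_on UNIV (g t)"
      and V: "V = {v. \<forall>t\<in>{1..T}. g t v \<le> 0}"
    using assms unfolding uncertainty_set_def by blast
  have "closed {v. g t v \<le> 0}" if "t \<in> {1..T}" for t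
    using g that by (intro closed_Collect_le convex_on_continuous continuous_intros) auto
  moreover have "V = (\<Inter>t\<in>{1..T}. {v. g t v \<le> 0})"
    using V by auto
  ultimately have "closed V"
    by auto
  then show ?thesis
    using assms by (simp add: uncertainty_set_def compact_eq_bounded_closed)
qed

lemma min_over_eqI:
  assumes "v \<in> S" "\<And>w. w \<in> S \<Longrightarrow> f v \<le> f w"
  shows "min_over f S = f v"
  unfolding min_over_def by (rule Least_equality) (use assms in auto)

text \<open>
  At a convex combination of two points, evaluate the concave function \<open>F v\<close> for the minimiser
  \<open>v\<close> there; its values at the two points are at least the minima at these points.
\<close>

lemma concave_on_min_over:
  fixes F :: "'b \<Rightarrow> 'a::real_vector \<Rightarrow> real"
  assumes "convex S"
    and conc: "\<And>v. v \<in> V \<Longrightarrow> concave_on S (F v)"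
    and attained: "\<And>x. x \<in> S \<Longrightarrow> \<exists>v\<in>V. \<forall>w\<in>V. F v x \<le> F w x"
  shows "concave_on S (\<lambda>x. min_over (\<lambda>v. F v x) V)"
proof -
  have lower: "min_over (\<lambda>v. F v x) V \<le> F w x" if "x \<in> S" "w \<in> V" for x w
    using attained[OF that(1)] min_over_eqI[of _ V "\<lambda>v. F v x"] that(2) by force
  have "u * min_over (\<lambda>v. F v x) V + t * min_over (\<lambda>v. F v y) V
        \<le> min_over (\<lambda>v. F v (u *\<^sub>R x + t *\<^sub>R y)) V"
    if xy: "x \<in> S" "y \<in> S" and ut: "0 \<le> u" "0 \<le> t" "u + t = 1" for x y u t
  proof -
    let ?z = "u *\<^sub>R x + t *\<^sub>R y"
    have "?z \<in> S"
      using \<open>convex S\<close> xy ut by (simp add: convexD)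
    then obtain v where v: "v \<in> V" "\<forall>w\<in>V. F v ?z \<le> F w ?z"
      using attained by blast
    have "u * min_over (\<lambda>v. F v x) V + t * min_over (\<lambda>v. F v y) V \<le> u * F v x + t * F v y"
      using lower v(1) xy ut by (intro add_mono mult_left_mono) auto
    also have "\<dots> \<le> F v ?z"
      using conc[OF v(1)] xy ut by (auto simp: concave_on_iff)
    also have "\<dots> = min_over (\<lambda>v. F v ?z) V"
      using v by (intro min_over_eqI[symmetric]) auto
    finally show ?thesis .
  qed
  with \<open>convex S\<close> show ?thesis
    by (auto simp: concave_on_iff)
qed

text \<open>
  Antitonicity of the reciprocal turns the concavity inequality for \<open>f\<close> around, and convexity of
  the reciprocal then splits the convex combination.
\<close>

lemma convex_on_inverse_concave:
  fixes f :: "'a::real_vector \<Rightarrow> real"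
  assumes conc: "concave_on S f" and pos: "\<And>x. x \<in> S \<Longrightarrow> 0 < f x"
  shows "convex_on S (\<lambda>x. inverse (f x))"
proof -
  have S: "convex S"
    using conc by (simp add: concave_on_iff)
  have inv: "convex_on {0<..} (inverse :: real \<Rightarrow> real)"
    by (rule convex_on_inverse) auto
  have "inverse (f (u *\<^sub>R x + t *\<^sub>R y)) \<le> u * inverse (f x) + t * inverse (f y)"
    if xy: "x \<in> S" "y \<in> S" and ut: "0 \<le> u" "0 \<le> t" "u + t = 1" for x y u t
  proof -
    have "0 < u *\<^sub>R f x + t *\<^sub>R f y"
      using convexD[OF convex_real_interval(3)[of 0], of "f x" "f y" u t] pos xy ut by auto
    moreover have "u * f x + t * f y \<le> f (u *\<^sub>R x + t *\<^sub>R y)"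
      using conc xy ut by (auto simp: concave_on_iff)
    ultimately have "inverse (f (u *\<^sub>R x + t *\<^sub>R y)) \<le> inverse (u * f x + t * f y)"
      by (intro le_imp_inverse_le) auto
    also have "\<dots> \<le> u * inverse (f x) + t * inverse (f y)"
      using inv pos xy ut by (auto simp: convex_on_def)
    finally show ?thesis .
  qed
  with S show ?thesis
    by (auto simp: convex_on_def)
qed

lemma convex_on_pointwise_sum:
  assumes "convex S" "finite I" "\<And>i. i \<in> I \<Longrightarrow> convex_on S (f i)"
  shows "convex_on S (\<lambda>x. \<Sum>i\<in>I. f i x)"
  using assms(2,3)
proof (induction I rule: finite_induct)
  case empty
  then show ?case using \<open>convex S\<close> by (simp add: convex_on_const)
next
  case (insert i I)
  then show ?case by (simp add: convex_on_add)
qed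

theorem proposition5:
  fixes I :: "'i set"
    and q :: "'i \<Rightarrow> real"
    and V :: "'i \<Rightarrow> (real ^ 'n) set"
  assumes "finite I" and "I \<noteq> {}"
    and "\<And>i. i \<in> I \<Longrightarrow> q i > 0"
    and "\<And>i. i \<in> I \<Longrightarrow> uncertainty_set (V i)"
  shows "concave_on {x. \<forall>j. 0 \<le> x $ j \<and> x $ j \<le> 1} (worst_case_mnl I q V)"
proof -
  let ?X = "{x :: real ^ 'n. \<forall>j. 0 \<le> x $ j \<and> x $ j \<le> 1}"
  let ?F = "\<lambda>(v :: real ^ 'n) (x :: real ^ 'n). \<Sum>j\<in>UNIV. exp (v $ j) * x $ j"
  have X: "convex ?X"
    using convex_box_cart[of "\<lambda>_ s. 0 \<le> s \<and> s \<le> 1"] convex_real_interval(5)[of 0 1]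
    by (simp add: atLeastAtMost_def atLeast_def atMost_def Int_def)
  have conv: "convex_on ?X (\<lambda>x. q i * inverse (1 + min_over (\<lambda>v. ?F v x) (V i)))"
    if i: "i \<in> I" for i
  proof -
    have attained: "\<exists>v\<in>V i. \<forall>w\<in>V i. ?F v x \<le> ?F w x" for x
      using assms(4)[OF i] compact_uncertainty_set[OF assms(4)[OF i]]
      by (intro continuous_attains_inf continuous_intros) (auto simp: uncertainty_set_def)
    have lin: "?F v (u *\<^sub>R x + t *\<^sub>R y) = u * ?F v x + t * ?F v y" for v x y u t
      by (simp add: sum_distrib_left sum.distrib[symmetric] algebra_simps)
    have "concave_on ?X (?F v)" for v
      unfolding concave_on_iff lin using X by simp
    then have "concave_on ?X (\<lambda>x. min_over (\<lambda>v. ?F v x) (V i))"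
      using X attained by (intro concave_on_min_over) auto
    then have "concave_on ?X (\<lambda>x. 1 + min_over (\<lambda>v. ?F v x) (V i))"
      using X by (intro concave_on_add) (auto simp: concave_on_const)
    moreover have "0 < 1 + min_over (\<lambda>v. ?F v x) (V i)" if "x \<in> ?X" for x
    proof -
      obtain v where v: "v \<in> V i" "\<forall>w\<in>V i. ?F v x \<le> ?F w x"
        using attained by blast
      then have "min_over (\<lambda>v. ?F v x) (V i) = ?F v x"
        by (intro min_over_eqI) auto
      moreover have "0 \<le> ?F v x"
        using that by (intro sum_nonneg) auto
      ultimately show ?thesis by simp
    qed
    ultimately have "convex_on ?X (\<lambda>x. inverse (1 + min_over (\<lambda>v. ?F v x) (V i)))"
      by (rule convex_on_inverse_concave)
    then show ?thesis
      using assms(3)[OF i] by (intro convex_on_cmul) auto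
  qed
  have "convex_on ?X (\<lambda>x. \<Sum>i\<in>I. q i * inverse (1 + min_over (\<lambda>v. ?F v x) (V i)))"
    using X assms(1) conv by (rule convex_on_pointwise_sum)
  then have "concave_on ?X (\<lambda>x. (\<Sum>i\<in>I. q i) -
      (\<Sum>i\<in>I. q i * inverse (1 + min_over (\<lambda>v. ?F v x) (V i))))"
    using X by (intro concave_on_diff) (auto simp: concave_on_const)
  moreover have "worst_case_mnl I q V = (\<lambda>x. (\<Sum>i\<in>I. q i) -
      (\<Sum>i\<in>I. q i * inverse (1 + min_over (\<lambda>v. ?F v x) (V i))))"
    by (simp add: worst_case_mnl_def fun_eq_iff divide_inverse)
  ultimately show ?thesis by simp
qed

end
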